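(* Let $\mathbb{G}$ be the infinite rooted binary tree (every vertex has exactly two children), so that $\imath_E^*(\mathbb{G})>0$. If $\nu$ is a probability distribution on the positive integers which does not have an exponential tail, then the random stretch $\mathbb{G}^\nu$ satisfies $\imath_E^*(\mathbb{G}^\nu)=0$ almost surely.
   Context: For a graph $G$ and $S\subset V(G)$, $|S|$ is the cardinality of $S$, and $\partial S$ is the set of edges of $G$ with one end in $S$ and the other in $S^c$. $S$ is connected if the subgraph induced on $S$ is connected. For an infinite connected graph $G$ with basepoint $o$, the anchored expansion constant is $$\imath_E^*(G):=\lim_{n\to\infty}\inf\left\{\frac{|\partial S|}{|S|}: o\in S\subset V(G),\ S\text{ is connected},\ n\le |S|<\infty\right\};$$ it does not depend on $o$ (here one may take $o$ to be the root). Random stretch: let $\{L_e\}_{e\in E(\mathbb{G})}$ be independent random variables with law $\nu$, and replace each edge $e$ of $\mathbb{G}$ by a path consisting of $L_e$ new edges (joining the same two endpoints); the resulting random graph is $\mathbb{G}^\nu$. The law $\nu$ has an exponential tail if there is $\varepsilon>0$ such that $\nu[\ell,\infty)<e^{-\varepsilon\ell}$ for all sufficiently large $\ell$. *)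

theory Defs
  imports
    "HOL-Probability.Probability"
    "Graph_Theory.Digraph_Component"
begin

text \<open>
  An undirected (multi)graph is a \<^typ>\<open>('v, 'e) pre_digraph\<close> with exactly one arc for each
  undirected edge; the direction of the arc is a bookkeeping device without significance.
  Accordingly connectedness is always \<^const>\<open>Digraph_Component.connected\<close>, which is
  connectedness of the underlying symmetric graph.
\<close>

definition edge_boundary :: "('v, 'e) pre_digraph \<Rightarrow> 'v set \<Rightarrow> 'e set" where
  "edge_boundary G S = {e \<in> arcs G. (tail G e \<in> S) \<noteq> (head G e \<in> S)}"

definition anchored_sets :: "('v, 'e) pre_digraph \<Rightarrow> 'v \<Rightarrow> nat \<Rightarrow> 'v set set" where
  "anchored_sets G r n =
     {S. r \<in> S \<and> S \<subseteq> verts G \<and> Digraph_Component.connected (G \<restriction> S) \<and> finite S \<and> n \<le> card S}"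

text \<open>
  Meant for locally finite graphs, where edge boundaries of finite sets are finite, so that
  \<^const>\<open>card\<close> counts them. The limit is taken in \<^typ>\<open>ereal\<close>, where it always exists
  (\<open>anchored_expansion_tendsto\<close> below).
\<close>

definition anchored_expansion :: "('v, 'e) pre_digraph \<Rightarrow> 'v \<Rightarrow> ereal" where
  "anchored_expansion G r =
     lim (\<lambda>n. INF S \<in> anchored_sets G r n.
                ereal (real (card (edge_boundary G S)) / real (card S)))"

lemma anchored_expansion_tendsto:
  "(\<lambda>n. INF S \<in> anchored_sets G r n.
          ereal (real (card (edge_boundary G S)) / real (card S)))
     \<longlonglongrightarrow> anchored_expansion G r"
proof -
  let ?f = "\<lambda>n. INF S \<in> anchored_sets G r n.
          ereal (real (card (edge_boundary G S)) / real (card S))"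
  have "incseq ?f"
  proof (rule incseq_SucI)
    fix n
    have "anchored_sets G r (Suc n) \<subseteq> anchored_sets G r n"
      by (auto simp: anchored_sets_def)
    then show "?f n \<le> ?f (Suc n)"
      by (rule INF_superset_mono) (rule order_refl)
  qed
  then have "?f \<longlonglongrightarrow> (SUP n. ?f n)"
    by (rule LIMSEQ_SUP)
  moreover from this have "lim ?f = (SUP n. ?f n)"
    by (rule limI)
  ultimately show ?thesis
    unfolding anchored_expansion_def by simp
qed

text \<open>
  The vertices are the finite 0-1 words, the root is the empty word, and the arc \<open>(v, b)\<close> is the
  edge joining \<open>v\<close> to its child \<open>b # v\<close>.
\<close>

definition binary_tree :: "(bool list, bool list \<times> bool) pre_digraph" where
  "binary_tree = \<lparr> verts = UNIV, arcs = UNIV, tail = fst, head = (\<lambda>(v, b). b # v) \<rparr>"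

text \<open>
  Each edge \<open>e\<close> becomes a path of \<open>L e \<ge> 1\<close> edges \<open>(e, 0), \<dots>, (e, L e - 1)\<close>. Old vertices are
  \<open>Inl v\<close>; the inner vertices of the path are \<open>Inr (e, i)\<close> with \<open>0 < i < L e\<close>, the edge \<open>(e, i)\<close>
  joining the \<open>i\<close>-th to the \<open>(i + 1)\<close>-st vertex of the path.
\<close>

definition stretch ::
  "('v, 'e) pre_digraph \<Rightarrow> ('e \<Rightarrow> nat) \<Rightarrow> ('v + 'e \<times> nat, 'e \<times> nat) pre_digraph" where
  "stretch G L =
     \<lparr> verts = Inl ` verts G \<union> Inr ` {(e, i). e \<in> arcs G \<and> 0 < i \<and> i < L e},
       arcs = {(e, i). e \<in> arcs G \<and> i < L e},
       tail = (\<lambda>(e, i). if i = 0 then Inl (tail G e) else Inr (e, i)),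
       head = (\<lambda>(e, i). if Suc i = L e then Inl (head G e) else Inr (e, Suc i)) \<rparr>"

lemma wf_digraph_binary_tree: "wf_digraph binary_tree"
  by unfold_locales (auto simp: binary_tree_def)

lemma wf_digraph_stretch:
  assumes "wf_digraph G"
  shows "wf_digraph (stretch G L)"
proof -
  interpret wf_digraph G by fact
  show ?thesis by unfold_locales (auto simp: stretch_def split: if_splits)
qed

definition exponential_tail :: "nat pmf \<Rightarrow> bool" where
  "exponential_tail \<nu> \<longleftrightarrow>
     (\<exists>\<epsilon>>0. \<forall>\<^sub>F l in sequentially. measure_pmf.prob \<nu> {l..} < exp (- (\<epsilon> * real l)))"

end

theory Submission
  imports Defs "HOL-Library.Sublist"
begin

text \<open>
  In the binary tree a finite vertex set \<open>S\<close> emits \<open>2 |S|\<close> downward arcs, of which at most \<open>|S|\<close>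
  end in \<open>S\<close>, since a vertex has only one parent. Hence \<open>|\<partial>S| \<ge> |S|\<close> and the anchored expansion
  constant is at least 1 (\<open>card_edge_boundary_binary_tree\<close>).

  For the stretched tree it suffices to find paths from the root that end in one very long edge. If
  the edge below \<open>v\<close> at depth \<open>n\<close> has stretched length \<open>k\<close>, then the vertex set \<open>S\<close> of the
  stretched path from the root through this edge has at least \<open>k\<close> elements, but boundary edges leave it only at the \<open>n + 2\<close>
  old vertices, so \<open>|\<partial>S| \<le> 2 (n + 2)\<close> (\<open>card_stretched_path_ge\<close>,
  \<open>card_boundary_stretched_path_le\<close>). It remains to find edges with \<open>n\<close> much smaller than \<open>k\<close>.

  Without an exponential tail, for every \<open>c > 0\<close> there are arbitrarily large \<open>l\<close> with
  \<open>\<nu>[l, \<infinity>) \<ge> 2 powr (- c l)\<close>. There are \<open>2 ^ (n + 1)\<close> edges at depth \<open>n\<close>, so for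
  \<open>n = \<lceil>2 c l\<rceil>\<close> the expected number of edges of length at least \<open>l\<close> at this depth is at least
  \<open>2 powr (c l)\<close>, and by independence the probability that there is none is at most
  \<open>exp (- (2 powr (c l)))\<close>. This tends to 0 as \<open>l\<close> grows, while \<open>n / l\<close> stays near \<open>2 c\<close>; so
  almost surely there is a long shallow edge for every prescribed ratio and length
  (\<open>AE_long_shallow_edge\<close>).
\<close>

section \<open>Bounds for the anchored expansion constant\<close>

lemma anchored_expansion_ge:
  assumes "\<And>S. S \<in> anchored_sets G r 0 \<Longrightarrow> c \<le> real (card (edge_boundary G S)) / real (card S)"
  shows "ereal c \<le> anchored_expansion G r"
proof (rule LIMSEQ_le_const[OF anchored_expansion_tendsto], intro exI allI impI INF_greatest)
  fix n S assume "S \<in> anchored_sets G r n"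
  then show "ereal c \<le> ereal (real (card (edge_boundary G S)) / real (card S))"
    using assms[of S] by (simp add: anchored_sets_def)
qed

lemma anchored_expansion_eq_0I:
  assumes "\<And>n \<delta>. \<delta> > 0 \<Longrightarrow>
    \<exists>S\<in>anchored_sets G r n. real (card (edge_boundary G S)) / real (card S) \<le> \<delta>"
  shows "anchored_expansion G r = 0"
proof (rule antisym)
  show "0 \<le> anchored_expansion G r"
    using anchored_expansion_ge[of G r 0] by (simp add: zero_ereal_def)
  show "anchored_expansion G r \<le> 0"
  proof (rule LIMSEQ_le_const2[OF anchored_expansion_tendsto], intro exI allI impI)
    fix n
    show "(INF S \<in> anchored_sets G r n.
        ereal (real (card (edge_boundary G S)) / real (card S))) \<le> 0"
    proof (rule ereal_le_epsilon2)
      fix \<delta> :: real assume "\<delta> > 0"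
      with assms obtain S where "S \<in> anchored_sets G r n"
        "real (card (edge_boundary G S)) / real (card S) \<le> \<delta>" by blast
      then show "(INF S \<in> anchored_sets G r n.
        ereal (real (card (edge_boundary G S)) / real (card S))) \<le> 0 + ereal \<delta>"
        by (intro INF_lower2[of S]) auto
    qed
  qed
qed

section \<open>Expansion of the binary tree\<close>

lemma card_edge_boundary_binary_tree:
  assumes "finite S"
  shows "card S \<le> card (edge_boundary binary_tree S)"
proof -
  \<comment> \<open>the arcs from \<open>S\<close> down to children that stay in \<open>S\<close>\<close>
  define I where "I = {e \<in> S \<times> UNIV. snd e # fst e \<in> S}"
  have "finite I" using assms by (auto simp: I_def)
  have "card I \<le> card S"
    by (rule card_inj_on_le[of "\<lambda>e. snd e # fst e"]) (use assms in \<open>auto simp: I_def inj_on_def\<close>)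
  moreover have "S \<times> UNIV - I \<subseteq> edge_boundary binary_tree S"
    by (auto simp: I_def edge_boundary_def binary_tree_def)
  moreover have "finite (edge_boundary binary_tree S)"
  proof (rule finite_subset)
    show "edge_boundary binary_tree S \<subseteq> S \<times> UNIV \<union> (\<lambda>w. (tl w, hd w)) ` S"
      by (force simp: edge_boundary_def binary_tree_def)
  qed (use assms in auto)
  ultimately have "card (S \<times> (UNIV :: bool set) - I) \<le> card (edge_boundary binary_tree S)"
    using card_mono by blast
  moreover have "card (S \<times> (UNIV :: bool set) - I) = 2 * card S - card I"
    using \<open>finite I\<close> by (subst card_Diff_subset) (auto simp: I_def card_cartesian_product)
  ultimately show ?thesis using \<open>card I \<le> card S\<close> by linarith
qed

lemma anchored_expansion_binary_tree_pos: "anchored_expansion binary_tree [] > 0"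
proof -
  have "ereal 1 \<le> anchored_expansion binary_tree []"
  proof (rule anchored_expansion_ge)
    fix S assume "S \<in> anchored_sets binary_tree [] 0"
    then have "finite S" "card S > 0" by (auto simp: anchored_sets_def card_gt_0_iff)
    with card_edge_boundary_binary_tree[of S]
    show "1 \<le> real (card (edge_boundary binary_tree S)) / real (card S)"
      by (simp add: le_divide_eq)
  qed
  then show ?thesis by (rule less_le_trans[rotated]) simp
qed

section \<open>Stretched paths from the root\<close>

lemma (in wf_digraph) connected_if_reachable_from:
  assumes "r \<in> verts G" and "\<And>v. v \<in> verts G \<Longrightarrow> r \<rightarrow>\<^sup>* v"
  shows "Digraph_Component.connected G"
proof -
  interpret S: pair_wf_digraph "mk_symmetric G" ..
  have from_r: "r \<rightarrow>\<^sup>*\<^bsub>with_proj (mk_symmetric G)\<^esub> v" if "v \<in> verts G" for v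
    using assms(2)[OF that] by (rule reachable_mk_symmetricI)
  have to_r: "v \<rightarrow>\<^sup>*\<^bsub>with_proj (mk_symmetric G)\<^esub> r" if "v \<in> verts G" for v
    using symmetric_mk_symmetric from_r[OF that] by (rule symmetric_reachable)
  show ?thesis
    unfolding connected_def
  proof (rule strongly_connectedI)
    fix u v assume "u \<in> verts (with_proj (mk_symmetric G))" "v \<in> verts (with_proj (mk_symmetric G))"
    then show "u \<rightarrow>\<^sup>*\<^bsub>with_proj (mk_symmetric G)\<^esub> v"
      by (intro S.reachable_trans[OF to_r from_r]) auto
  qed (use assms(1) in auto)
qed

text \<open>
  The vertices of the stretched path from the root down to the old vertex \<open>w\<close>. Since words grow at
  the front, the ancestors of \<open>w\<close> are its suffixes.
\<close>

definition stretched_path ::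
  "(bool list \<times> bool \<Rightarrow> nat) \<Rightarrow> bool list \<Rightarrow> (bool list + (bool list \<times> bool) \<times> nat) set" where
  "stretched_path L w =
     Inl ` {u. suffix u w} \<union> Inr ` {((u, c), i). suffix (c # u) w \<and> 0 < i \<and> i < L (u, c)}"

lemma finite_suffixes: "finite {u. suffix u w}"
  by (metis List.finite_set set_suffixes_eq)

lemma card_suffixes: "card {u. suffix u w} = Suc (length w)"
  by (metis distinct_card distinct_suffixes length_suffixes set_suffixes_eq)

lemma finite_stretched_path: "finite (stretched_path L w)"
proof -
  have "{((u, c), i). suffix (c # u) w \<and> 0 < i \<and> i < L (u, c)}
      \<subseteq> (\<Union>x\<in>{u. suffix u w}. {((tl x, hd x), i) | i. i < L (tl x, hd x)})"
    by force
  then have "finite {((u, c), i). suffix (c # u) w \<and> 0 < i \<and> i < L (u, c)}"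
    by (rule finite_subset) (auto simp: finite_suffixes)
  then show ?thesis by (auto simp: stretched_path_def finite_suffixes)
qed

lemma card_stretched_path_ge: "L (v, b) \<le> card (stretched_path L (b # v))"
proof -
  \<comment> \<open>the stretched edge below \<open>v\<close>, its with \<open>v\<close> as its vertex of index 0\<close>
  let ?f = "\<lambda>i. if i = 0 then Inl v else Inr ((v, b), i)"
  have "?f ` {..<L (v, b)} \<subseteq> stretched_path L (b # v)"
    by (auto simp: stretched_path_def suffix_Cons)
  moreover have "inj_on ?f {..<L (v, b)}" by (auto simp: inj_on_def)
  ultimately show ?thesis
    using card_inj_on_le[of ?f "{..<L (v, b)}"] finite_stretched_path by fastforce
qed

lemma card_boundary_stretched_path_le:
  "card (edge_boundary (stretch binary_tree L) (stretched_path L w)) \<le> 2 * Suc (length w)"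
proof -
  \<comment> \<open>a boundary edge is the first segment of a stretched edge hanging off an old vertex\<close>
  have "edge_boundary (stretch binary_tree L) (stretched_path L w)
      \<subseteq> ({u. suffix u w} \<times> UNIV) \<times> {0}"
    by (auto simp: edge_boundary_def stretch_def binary_tree_def stretched_path_def
        split: if_splits dest: suffix_ConsD)
  then have "card (edge_boundary (stretch binary_tree L) (stretched_path L w))
      \<le> card (({u. suffix u w} \<times> (UNIV :: bool set)) \<times> {0 :: nat})"
    by (intro card_mono) (auto simp: finite_suffixes)
  then show ?thesis by (simp add: card_cartesian_product card_suffixes)
qed

lemma stretched_path_anchored:
  assumes pos: "\<And>e. 0 < L e" and n: "n \<le> card (stretched_path L w)"
  shows "stretched_path L w \<in> anchored_sets (stretch binary_tree L) (Inl []) n"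
proof -
  let ?S = "stretched_path L w"
  let ?H = "stretch binary_tree L \<restriction> ?S"
  interpret H: wf_digraph ?H
    by (intro wf_digraph.wellformed_induce_subgraph wf_digraph_stretch wf_digraph_binary_tree)
  have step: "tail (stretch binary_tree L) (e, i) \<rightarrow>\<^bsub>?H\<^esub> head (stretch binary_tree L) (e, i)"
    if "tail (stretch binary_tree L) (e, i) \<in> ?S" "head (stretch binary_tree L) (e, i) \<in> ?S"
      "i < L e" for e i
  proof -
    have "(e, i) \<in> arcs ?H" using that by (auto simp: stretch_def binary_tree_def)
    from H.in_arcs_imp_in_arcs_ends[OF this] show ?thesis by simp
  qed
  \<comment> \<open>the vertex of index 0 of a stretched edge is its old top vertex\<close>
  have inner: "Inl [] \<rightarrow>\<^sup>*\<^bsub>?H\<^esub> Inr ((u, c), i)"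
    if u: "Inl [] \<rightarrow>\<^sup>*\<^bsub>?H\<^esub> Inl u" and s: "suffix (c # u) w" and i: "0 < i" "i < L (u, c)" for u c i
    using i
  proof (induction i)
    case (Suc i)
    have "(if i = 0 then Inl u else Inr ((u, c), i)) \<rightarrow>\<^bsub>?H\<^esub> Inr ((u, c), Suc i)"
      using step[of "(u, c)" i] Suc.prems s
      by (auto simp: stretch_def binary_tree_def stretched_path_def dest: suffix_ConsD
          split: if_splits)
    then show ?case using Suc u by (cases "i = 0") (auto intro: H.reachable_adj_trans)
  qed simp
  have old: "Inl [] \<rightarrow>\<^sup>*\<^bsub>?H\<^esub> Inl u" if "suffix u w" for u
    using that
  proof (induction u)
    case Nil
    then show ?case by (intro H.reachable_refl) (simp add: stretched_path_def)
  next
    case (Cons c u)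
    then have u: "Inl [] \<rightarrow>\<^sup>*\<^bsub>?H\<^esub> Inl u" by (auto dest: suffix_ConsD)
    let ?i = "L (u, c) - 1"
    have "(if ?i = 0 then Inl u else Inr ((u, c), ?i)) \<rightarrow>\<^bsub>?H\<^esub> Inl (c # u)"
      using step[of "(u, c)" ?i] Cons.prems pos[of "(u, c)"]
      by (auto simp: stretch_def binary_tree_def stretched_path_def dest: suffix_ConsD
          split: if_splits)
    moreover have "Inl [] \<rightarrow>\<^sup>*\<^bsub>?H\<^esub> (if ?i = 0 then Inl u else Inr ((u, c), ?i))"
      using u inner[OF u Cons.prems, of ?i] by auto
    ultimately show ?case by (rule H.reachable_adj_trans[rotated])
  qed
  have "Inl [] \<in> ?S" by (simp add: stretched_path_def)
  moreover have "?S \<subseteq> verts (stretch binary_tree L)"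
    by (auto simp: stretched_path_def stretch_def binary_tree_def)
  moreover have "Digraph_Component.connected ?H"
  proof (rule H.connected_if_reachable_from)
    show "Inl [] \<in> verts ?H" by (simp add: stretched_path_def)
    fix x assume "x \<in> verts ?H"
    then consider u where "x = Inl u" "suffix u w"
      | u c i where "x = Inr ((u, c), i)" "suffix (c # u) w" "0 < i" "i < L (u, c)"
      by (auto simp: stretched_path_def)
    then show "Inl [] \<rightarrow>\<^sup>*\<^bsub>?H\<^esub> x"
    proof cases
      case 2
      then show ?thesis using inner[OF old] by (auto dest: suffix_ConsD)
    qed (simp add: old)
  qed
  ultimately show ?thesis
    using n finite_stretched_path by (simp add: anchored_sets_def)
qed

lemma anchored_expansion_stretch_eq_0:
  assumes pos: "\<And>e. 0 < L e"
    and shallow: "\<And>n k. \<exists>v b. n \<le> L (v, b) \<and> real (Suc k) * (2 * (length v + 2)) \<le> L (v, b)"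
  shows "anchored_expansion (stretch binary_tree L) (Inl []) = 0"
proof (rule anchored_expansion_eq_0I)
  fix n and \<delta> :: real assume "\<delta> > 0"
  then obtain k where k: "inverse (Suc k) < \<delta>" using reals_Archimedean by blast
  from shallow obtain v b
    where vb: "n \<le> L (v, b)" "real (Suc k) * (2 * (length v + 2)) \<le> L (v, b)" by blast
  let ?S = "stretched_path L (b # v)"
  have card: "L (v, b) \<le> card ?S" by (rule card_stretched_path_ge)
  have "real (card (edge_boundary (stretch binary_tree L) ?S)) * Suc k
      \<le> real (2 * (length v + 2)) * Suc k"
    using card_boundary_stretched_path_le[of L "b # v"]
    by (intro mult_right_mono of_nat_mono) auto
  also have "\<dots> \<le> card ?S" using vb(2) card by (simp add: mult.commute)
  finally have "real (card (edge_boundary (stretch binary_tree L) ?S)) / card ?S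
      \<le> inverse (Suc k)"
    using card pos[of "(v, b)"] by (simp add: field_simps)
  with k have "real (card (edge_boundary (stretch binary_tree L) ?S)) / card ?S \<le> \<delta>" by linarith
  moreover have "?S \<in> anchored_sets (stretch binary_tree L) (Inl []) n"
    using pos vb(1) card by (intro stretched_path_anchored) auto
  ultimately show "\<exists>S\<in>anchored_sets (stretch binary_tree L) (Inl []) n.
      real (card (edge_boundary (stretch binary_tree L) S)) / card S \<le> \<delta>" by blast
qed

section \<open>Long edges near the root\<close>

text \<open>The edges joining depth \<open>n\<close> to depth \<open>n + 1\<close>.\<close>

definition level_edges :: "nat \<Rightarrow> (bool list \<times> bool) set" where
  "level_edges n = {v. length v = n} \<times> UNIV"

lemma finite_level_edges: "finite (level_edges n)"
  and card_level_edges: "card (level_edges n) = 2 ^ Suc n"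
proof -
  show "finite (level_edges n)"
    using finite_lists_length_eq[of "UNIV :: bool set" n] by (simp add: level_edges_def)
  show "card (level_edges n) = 2 ^ Suc n"
    using card_lists_length_eq[of "UNIV :: bool set" n]
    by (simp add: level_edges_def card_cartesian_product)
qed

lemma not_exponential_tailD:
  assumes "\<not> exponential_tail \<nu>" "\<epsilon> > 0"
  obtains l where "l \<ge> N" "exp (- (\<epsilon> * real l)) \<le> measure_pmf.prob \<nu> {l..}"
proof -
  from assms have "\<exists>\<^sub>F l in sequentially. \<not> measure_pmf.prob \<nu> {l..} < exp (- (\<epsilon> * real l))"
    by (auto simp: exponential_tail_def frequently_def)
  then show ?thesis using that by (auto simp: frequently_sequentially not_less)
qed

context prob_space
begin

lemma prob_no_long_level_edge_le:
  fixes L :: "bool list \<times> bool \<Rightarrow> 'a \<Rightarrow> nat"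
  assumes indep: "indep_vars (\<lambda>_. count_space UNIV) L UNIV"
    and distr: "\<And>e. distr M (count_space UNIV) (L e) = measure_pmf \<nu>"
  shows "prob {\<omega> \<in> space M. \<forall>e\<in>level_edges n. L e \<omega> < l}
    \<le> exp (- (measure_pmf.prob \<nu> {l..} * 2 ^ n))"
proof -
  let ?p = "measure_pmf.prob \<nu> {l..}"
  have rv: "L e \<in> measurable M (count_space UNIV)" for e
    using indep unfolding indep_vars_def by blast
  have ne: "level_edges n \<noteq> {}"
    using card_level_edges[of n] by force
  have p: "prob (L e -` {..<l} \<inter> space M) = 1 - ?p" for e
  proof -
    have "prob (L e -` {..<l} \<inter> space M) = measure_pmf.prob \<nu> {..<l}"
      by (subst distr[symmetric, of e], subst measure_distr[OF rv]) auto
    also have "\<dots> = measure_pmf.prob \<nu> (space (measure_pmf \<nu>) - {l..})"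
      by (rule arg_cong[where f = "measure_pmf.prob \<nu>"]) auto
    also have "\<dots> = 1 - ?p"
      by (subst measure_pmf.prob_compl) auto
    finally show ?thesis .
  qed
  have "{\<omega> \<in> space M. \<forall>e\<in>level_edges n. L e \<omega> < l}
      = (\<Inter>e\<in>level_edges n. L e -` {..<l} \<inter> space M)"
    using ne by auto
  then have "prob {\<omega> \<in> space M. \<forall>e\<in>level_edges n. L e \<omega> < l}
      = (\<Prod>e\<in>level_edges n. prob (L e -` {..<l} \<inter> space M))"
    using indep_varsD[OF indep ne finite_level_edges, of "\<lambda>_. {..<l}"] by simp
  also have "\<dots> = (1 - ?p) ^ 2 ^ Suc n"
    by (simp add: p card_level_edges del: power_Suc)
  also have "\<dots> \<le> exp (- ?p) ^ 2 ^ Suc n"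
    using exp_ge_add_one_self[of "- ?p"] by (intro power_mono) auto
  also have "\<dots> = exp (- (?p * 2 ^ Suc n))"
    by (simp add: exp_of_nat_mult[symmetric] mult.commute)
  also have "\<dots> \<le> exp (- (?p * 2 ^ n))"
    by simp
  finally show ?thesis .
qed

lemma AE_long_shallow_edge:
  fixes L :: "bool list \<times> bool \<Rightarrow> 'a \<Rightarrow> nat" and K :: real
  assumes tail: "\<not> exponential_tail \<nu>"
    and indep: "indep_vars (\<lambda>_. count_space UNIV) L UNIV"
    and distr: "\<And>e. distr M (count_space UNIV) (L e) = measure_pmf \<nu>"
    and "K > 0"
  shows "AE \<omega> in M. \<exists>v b. m \<le> L (v, b) \<omega> \<and> K * (2 * (length v + 2)) \<le> L (v, b) \<omega>"
proof -
  define B where "B = {\<omega> \<in> space M.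
    \<forall>v b. \<not> (m \<le> L (v, b) \<omega> \<and> K * (2 * (length v + 2)) \<le> L (v, b) \<omega>)}"
  have rv [measurable]: "L e \<in> measurable M (count_space UNIV)" for e
    using indep unfolding indep_vars_def by blast
  have B: "B \<in> events" unfolding B_def by measurable
  have "prob B \<le> 0 + \<eta>" if "\<eta> > 0" for \<eta>
  proof -
    \<comment> \<open>with this \<open>c\<close>, depth \<open>2 c l\<close> contributes \<open>K * (4 c l) = l / 2\<close> to the boundary bound,
        which leaves \<open>l / 2\<close> for the additive constants\<close>
    define c where "c = 1 / (8 * K)"
    have "c > 0" using \<open>K > 0\<close> by (simp add: c_def)
    define N where "N = m + nat \<lceil>12 * K\<rceil> + nat \<lceil>- ln \<eta> / (c * ln 2)\<rceil>"
    obtain l where l: "l \<ge> N" "exp (- (c * ln 2 * real l)) \<le> measure_pmf.prob \<nu> {l..}"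
      using not_exponential_tailD[OF tail, of "c * ln 2" N] \<open>c > 0\<close> by auto
    have "l \<ge> m" and l_K: "real l \<ge> 12 * K" and l_\<eta>: "real l \<ge> - ln \<eta> / (c * ln 2)"
      using l(1) unfolding N_def by linarith+
    define n where "n = nat \<lceil>2 * c * l\<rceil>"
    have n: "2 * c * l \<le> n" "n \<le> 2 * c * l + 1"
    proof -
      have "0 \<le> 2 * c * l" using \<open>c > 0\<close> by simp
      then show "2 * c * l \<le> n" "n \<le> 2 * c * l + 1" unfolding n_def by linarith+
    qed
    have "K * (2 * (real n + 2)) \<le> K * (2 * (2 * c * l + 3))"
      using n \<open>K > 0\<close> by (intro mult_left_mono) auto
    also have "\<dots> = l / 2 + 6 * K" using \<open>K > 0\<close> by (simp add: c_def field_simps)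
    also have "\<dots> \<le> l" using l_K by simp
    finally have shallow: "K * (2 * (real n + 2)) \<le> l" .
    have "B \<subseteq> {\<omega> \<in> space M. \<forall>e\<in>level_edges n. L e \<omega> < l}"
    proof safe
      fix \<omega> v b assume "\<omega> \<in> B" and e: "(v, b) \<in> level_edges n"
      then have "\<not> (m \<le> L (v, b) \<omega> \<and> K * (2 * (length v + 2)) \<le> L (v, b) \<omega>)"
        by (auto simp: B_def)
      then show "L (v, b) \<omega> < l"
        using e shallow \<open>l \<ge> m\<close> by (auto simp: level_edges_def not_le algebra_simps)
    qed (simp add: B_def)
    then have "prob B \<le> prob {\<omega> \<in> space M. \<forall>e\<in>level_edges n. L e \<omega> < l}"
      by (rule finite_measure_mono) measurable
    also have "\<dots> \<le> exp (- (measure_pmf.prob \<nu> {l..} * 2 ^ n))"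
      using indep distr by (rule prob_no_long_level_edge_le)
    also have "\<dots> \<le> exp (- exp (c * ln 2 * l))"
    proof -
      have "exp (2 * (c * ln 2 * l)) = exp (ln 2 * (2 * c * l))" by (simp add: mult_ac)
      also have "\<dots> \<le> exp (ln 2 * n)" using n by simp
      also have "\<dots> = 2 ^ n" by (simp add: exp_of_nat2_mult)
      finally have "exp (- (c * ln 2 * real l)) * exp (2 * (c * ln 2 * l))
          \<le> measure_pmf.prob \<nu> {l..} * 2 ^ n"
        using l(2) by (intro mult_mono) auto
      then show ?thesis by (simp add: mult_ac flip: exp_add)
    qed
    also have "\<dots> \<le> exp (- (c * ln 2 * l))"
      using exp_ge_add_one_self[of "c * ln 2 * l"] by (simp del: exp_ge_add_one_self)
    also have "\<dots> \<le> exp (ln \<eta>)"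
    proof -
      have "c * ln 2 > 0" using \<open>c > 0\<close> by simp
      then have "- ln \<eta> \<le> c * ln 2 * l" using l_\<eta> by (simp only: pos_divide_le_eq mult.commute)
      then show ?thesis by simp
    qed
    finally show ?thesis using that by simp
  qed
  then have "prob B \<le> 0" by (rule field_le_epsilon)
  then have "prob B = 0" using measure_nonneg[of M B] by linarith
  then have "AE \<omega> in M. \<omega> \<notin> B" using B prob_eq_0 by blast
  then show ?thesis by (rule AE_mp) (auto simp: B_def intro!: AE_I2)
qed

end

theorem mainTheorem3:
  fixes \<nu> :: "nat pmf"
    and M :: "'w measure"
    and L :: "bool list \<times> bool \<Rightarrow> 'w \<Rightarrow> nat"
  assumes "prob_space M"
    and "set_pmf \<nu> \<subseteq> {1..}"
    and "\<not> exponential_tail \<nu>"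
    and "prob_space.indep_vars M (\<lambda>_. count_space UNIV) L (arcs binary_tree)"
    and "\<And>e. e \<in> arcs binary_tree \<Longrightarrow> distr M (count_space UNIV) (L e) = measure_pmf \<nu>"
  shows "anchored_expansion binary_tree [] > 0 \<and>
    (AE \<omega> in M. anchored_expansion (stretch binary_tree (\<lambda>e. L e \<omega>)) (Inl []) = 0)"
proof
  show "anchored_expansion binary_tree [] > 0"
    by (rule anchored_expansion_binary_tree_pos)
  interpret prob_space M by fact
  have indep: "indep_vars (\<lambda>_. count_space UNIV) L UNIV"
    using assms(4) by (simp add: binary_tree_def)
  have distr: "distr M (count_space UNIV) (L e) = measure_pmf \<nu>" for e
    using assms(5) by (simp add: binary_tree_def)
  have rv: "L e \<in> measurable M (count_space UNIV)" for e
    using indep unfolding indep_vars_def by blast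
  have "AE \<omega> in M. 0 < L e \<omega>" for e
  proof -
    have "AE k in measure_pmf \<nu>. 0 < k"
      using assms(2) by (auto simp: AE_measure_pmf_iff)
    then have "AE k in distr M (count_space UNIV) (L e). 0 < k" by (simp only: distr)
    then show ?thesis by (subst (asm) AE_distr_iff[OF rv]) auto
  qed
  then have "AE \<omega> in M. \<forall>e. 0 < L e \<omega>" by (simp add: AE_all_countable)
  moreover have "AE \<omega> in M. \<forall>n k. \<exists>v b.
      n \<le> L (v, b) \<omega> \<and> real (Suc k) * (2 * (length v + 2)) \<le> L (v, b) \<omega>"
    unfolding AE_all_countable
    by (intro allI AE_long_shallow_edge[OF assms(3) indep distr]) simp
  ultimately show "AE \<omega> in M. anchored_expansion (stretch binary_tree (\<lambda>e. L e \<omega>)) (Inl []) = 0"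
    by eventually_elim (rule anchored_expansion_stretch_eq_0, auto)
qed

end
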